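(* Let $g=([n],E)$ be a hypergraph. If $[n]\in E$, then $g$ is not LU equivalent to any hypergraph (on the vertex set $[n]$) which does not include the hyperedge $[n]$.
   Context: For a positive integer $n$, $[n]=\{1,2,\dots,n\}$. A hypergraph is a pair $(V,E)$ with $V$ a finite set of vertices and $E\subseteq\wp(V)$ (the power set of $V$) a set of hyperedges; the empty hyperedge $\varnothing$ and one-element hyperedges are allowed. The $n$-qubit hypergraph state of $g=([n],E)$ is the unit vector in $(\mathbb{C}^2)^{\otimes n}$ $$|g\rangle=\frac{1}{\sqrt{2^n}}\sum_{x\in\{0,1\}^n}(-1)^{u(g)(x)}|x_1\rangle\otimes\cdots\otimes|x_n\rangle,\qquad u(g)(x_1,\dots,x_n)=\bigoplus_{e\in E}\ \prod_{k\in e}x_k,$$ where $\oplus$ is addition modulo 2 and the empty product equals $1$. Equivalently, $|g\rangle=\prod_{e\in E}Z_e|+\rangle^{\otimes n}$, where $|+\rangle=\frac{1}{\sqrt2}(|0\rangle+|1\rangle)$ and $Z_e$ is the diagonal operator multiplying $|x\rangle$ by $-1$ exactly when $x_k=1$ for all $k\in e$. Two hypergraphs $g,g'$ on the vertex set $[n]$ are LU equivalent if there exist $2\times 2$ unitary matrices $U_1,\dots,U_n$ such that $|g\rangle=(U_1\otimes U_2\otimes\cdots\otimes U_n)|g'\rangle$, i.e. $|g\rangle$ and $|g'\rangle$ are equivalent under local unitary operations.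
   Formalization: The formal statement assumes n ≥ 2; for n = 1 the claim is false, since the state of ([1],{{1}}) is Z applied to the state of ([1],∅), and every one-vertex hypergraph containing [1] fails in the same way. *)

theory Defs
  imports "Jordan_Normal_Form.Schur_Decomposition" "HOL-Library.FuncSet"
begin

definition hypergraph :: "nat set \<Rightarrow> nat set set \<Rightarrow> bool" where
  "hypergraph V E \<longleftrightarrow> finite V \<and> E \<subseteq> Pow V"

text \<open>
  The qubits are numbered from \<open>1\<close> to \<open>n\<close>. A bit string is an extensional function on \<open>{1..n}\<close>,
  so that equality of bit strings is equality of functions.
\<close>

definition bit_strings :: "nat \<Rightarrow> (nat \<Rightarrow> nat) set" where
  "bit_strings n = (\<Pi>\<^sub>E k\<in>{1..n}. {0, 1})"

text \<open>
  A vector of the \<open>n\<close>-fold tensor power of the space of complex 2-vectors is the function, extensional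
  on \<open>bit_strings n\<close>, that gives its coordinates in the computational basis.
\<close>

type_synonym state = "(nat \<Rightarrow> nat) \<Rightarrow> complex"

definition tensor_vec :: "nat \<Rightarrow> (nat \<Rightarrow> complex vec) \<Rightarrow> state" where
  "tensor_vec n v = (\<lambda>x\<in>bit_strings n. \<Prod>k\<in>{1..n}. v k $ x k)"

text \<open>
  The entry of \<open>U\<^sub>1 \<otimes> \<dots> \<otimes> U\<^sub>n\<close> at \<open>(x, y)\<close> is the product of the entries of the \<open>U\<^sub>k\<close> at
  \<open>(x\<^sub>k, y\<^sub>k)\<close>; see \<open>tensor_apply_tensor_vec\<close> below.
\<close>

definition tensor_apply :: "nat \<Rightarrow> (nat \<Rightarrow> complex mat) \<Rightarrow> state \<Rightarrow> state" where
  "tensor_apply n U \<psi> =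
    (\<lambda>x\<in>bit_strings n. \<Sum>y\<in>bit_strings n. (\<Prod>k\<in>{1..n}. U k $$ (x k, y k)) * \<psi> y)"

definition basis_state :: "nat \<Rightarrow> (nat \<Rightarrow> nat) \<Rightarrow> state" where
  "basis_state n x = tensor_vec n (\<lambda>k. unit_vec 2 (x k))"

definition parity_function :: "nat set set \<Rightarrow> (nat \<Rightarrow> nat) \<Rightarrow> nat" where
  "parity_function E x = (\<Sum>e\<in>E. \<Prod>k\<in>e. x k) mod 2"

definition hypergraph_state :: "nat \<Rightarrow> nat set set \<Rightarrow> state" where
  "hypergraph_state n E =
    (\<lambda>z\<in>bit_strings n. 1 / complex_of_real (sqrt (2 ^ n)) *
      (\<Sum>x\<in>bit_strings n. (- 1) ^ parity_function E x * basis_state n x z))"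

definition unitary_mat :: "nat \<Rightarrow> complex mat \<Rightarrow> bool" where
  "unitary_mat d U \<longleftrightarrow> U \<in> carrier_mat d d \<and> U * mat_adjoint U = 1\<^sub>m d \<and> mat_adjoint U * U = 1\<^sub>m d"

text \<open>
  For \<open>n = 1\<close> the edge sets \<open>{{1}}\<close> and \<open>{}\<close> are LU equivalent, via the Pauli matrix \<open>Z\<close>, so a result
  that separates hypergraphs with and without the hyperedge \<open>{1..n}\<close> needs \<open>n \<ge> 2\<close>.
\<close>

definition LU_equivalent :: "nat \<Rightarrow> nat set set \<Rightarrow> nat set set \<Rightarrow> bool" where
  "LU_equivalent n E E' \<longleftrightarrow>
    (\<exists>U. (\<forall>k\<in>{1..n}. unitary_mat 2 (U k)) \<and>
      hypergraph_state n E = tensor_apply n U (hypergraph_state n E'))"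

lemma finite_bit_strings: "finite (bit_strings n)"
  unfolding bit_strings_def by (intro finite_PiE) auto

lemma bit_strings_less_2:
  assumes "x \<in> bit_strings n" and "k \<in> {1..n}"
  shows "x k < 2"
  using PiE_mem[OF assms(1)[unfolded bit_strings_def] assms(2)] by auto

lemma tensor_apply_tensor_vec:
  assumes U: "\<And>k. k \<in> {1..n} \<Longrightarrow> U k \<in> carrier_mat 2 2"
    and v: "\<And>k. k \<in> {1..n} \<Longrightarrow> v k \<in> carrier_vec 2"
  shows "tensor_apply n U (tensor_vec n v) = tensor_vec n (\<lambda>k. U k *\<^sub>v v k)"
proof
  fix x
  show "tensor_apply n U (tensor_vec n v) x = tensor_vec n (\<lambda>k. U k *\<^sub>v v k) x"
  proof (cases "x \<in> bit_strings n")
    case True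
    have entry: "(\<Sum>j\<in>{0, 1}. U k $$ (x k, j) * v k $ j) = (U k *\<^sub>v v k) $ x k"
      if "k \<in> {1..n}" for k
    proof -
      have "{0..<2} = {0, 1::nat}"
        by auto
      then show ?thesis
        using U[OF that] v[OF that] bit_strings_less_2[OF True that]
        by (simp add: scalar_prod_def)
    qed
    have "tensor_apply n U (tensor_vec n v) x =
        (\<Sum>y\<in>bit_strings n. \<Prod>k\<in>{1..n}. U k $$ (x k, y k) * v k $ y k)"
      using True by (simp add: tensor_apply_def tensor_vec_def prod.distrib)
    also have "\<dots> = (\<Prod>k\<in>{1..n}. \<Sum>j\<in>{0, 1}. U k $$ (x k, j) * v k $ j)"
      unfolding bit_strings_def by (rule prod_sum_PiE[symmetric]) auto
    also have "\<dots> = (\<Prod>k\<in>{1..n}. (U k *\<^sub>v v k) $ x k)"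
      by (rule prod.cong) (use entry in auto)
    finally show ?thesis
      using True by (simp add: tensor_vec_def)
  next
    case False
    then show ?thesis
      by (simp add: tensor_apply_def tensor_vec_def)
  qed
qed

lemma basis_state_apply:
  assumes "x \<in> bit_strings n" and "z \<in> bit_strings n"
  shows "basis_state n x z = (if z = x then 1 else 0)"
proof (cases "z = x")
  case True
  then show ?thesis
    using assms bit_strings_less_2[OF assms(1)]
    by (simp add: basis_state_def tensor_vec_def)
next
  case False
  then obtain k where k: "k \<in> {1..n}" "z k \<noteq> x k"
    using PiE_ext[OF assms[unfolded bit_strings_def]] by metis
  then have "unit_vec 2 (x k) $ z k = (0 :: complex)"
    using assms bit_strings_less_2 by simp
  then show ?thesis
    using False assms k by (auto simp: basis_state_def tensor_vec_def)
qed

lemma hypergraph_state_apply: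
  assumes "x \<in> bit_strings n"
  shows "hypergraph_state n E x =
    (- 1) ^ parity_function E x / complex_of_real (sqrt (2 ^ n))"
proof -
  have "(\<Sum>y\<in>bit_strings n. (- 1) ^ parity_function E y * basis_state n y x) =
      (\<Sum>y\<in>bit_strings n. if y = x then (- 1) ^ parity_function E x else 0)"
    by (rule sum.cong) (auto simp: basis_state_apply assms)
  then show ?thesis
    using assms by (simp add: hypergraph_state_def finite_bit_strings)
qed

end

theory Submission
  imports Defs "HOL-Number_Theory.Cong"
begin

text \<open>
  Contracting all qubits but the first of \<open>\<psi> \<otimes> \<psi>\<close> with the antisymmetric form \<open>\<epsilon>\<close> on 2-vectors
  leaves a 2 by 2 matrix \<open>M\<close>. Since \<open>U\<^sup>T \<epsilon> U = det U \<cdot> \<epsilon>\<close>, local unitaries turn \<open>M\<close> into a unit multiple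
  of \<open>U\<^sub>1 M U\<^sub>1\<^sup>T\<close>, so the modulus of \<open>det M\<close> is an LU invariant. For a hypergraph state \<open>2\<^sup>n M\<close> has
  integer entries, and \<open>s t \<equiv> s + t - 1\<close> modulo 4 for odd \<open>s, t\<close> gives \<open>2\<^sup>n M\<^sub>a\<^sub>b \<equiv> S\<^sub>a + S\<^sub>b\<close> modulo 4, where
  \<open>S\<^sub>a\<close> is the (even) sum of the signs over the bit strings that start with \<open>a\<close>. Modulo 4, \<open>S\<^sub>0 + S\<^sub>1\<close>
  is 2 if the full hyperedge is present and 0 otherwise, since an edge \<open>e\<close> equals 1 on
  \<open>2\<^bsup>n - |e|\<^esup>\<close> bit strings. So \<open>4\<^sup>n det M\<close> is 4 modulo 8 in the first case and 0 modulo 8 in the second.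
\<close>

section \<open>Sums of products over bit strings\<close>

lemma sum_bit_strings_prod:
  fixes f :: "nat \<Rightarrow> nat \<Rightarrow> 'a::comm_semiring_1"
  shows "(\<Sum>x\<in>bit_strings n. \<Prod>k\<in>{1..n}. f k (x k)) = (\<Prod>k\<in>{1..n}. f k 0 + f k 1)"
proof -
  have "(\<Prod>k\<in>{1..n}. \<Sum>j\<in>{0, 1}. f k j) = (\<Sum>x\<in>bit_strings n. \<Prod>k\<in>{1..n}. f k (x k))"
    unfolding bit_strings_def by (rule prod_sum_PiE) auto
  then show ?thesis
    by simp
qed

lemma bit_strings_01:
  assumes "x \<in> bit_strings n" and "k \<in> {1..n}"
  shows "x k = 0 \<or> x k = 1"
  using bit_strings_less_2[OF assms] by linarith

lemma prod_head:
  fixes f :: "nat \<Rightarrow> 'a::comm_monoid_mult"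
  assumes "1 \<le> n"
  shows "(\<Prod>k\<in>{1..n}. f k) = f 1 * (\<Prod>k\<in>{2..n}. f k)"
  using prod.atLeast_Suc_atMost[OF assms, of f] by (simp add: numeral_2_eq_2)

section \<open>Contraction of two copies of a state, and the action of local operators on it\<close>

definition bilin :: "nat \<Rightarrow> (nat \<Rightarrow> nat \<Rightarrow> nat \<Rightarrow> 'a) \<Rightarrow> ((nat \<Rightarrow> nat) \<Rightarrow> 'a) \<Rightarrow> 'a::comm_ring_1" where
  "bilin n C \<psi> =
    (\<Sum>x\<in>bit_strings n. \<Sum>y\<in>bit_strings n. (\<Prod>k\<in>{1..n}. C k (x k) (y k)) * (\<psi> x * \<psi> y))"

text \<open>The operators move onto the kernel: each \<open>C k\<close> becomes
  \<open>U\<^sup>T C U\<close>, with a transpose and no conjugate because \<open>bilin\<close> is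
  bilinear, not sesquilinear. Distributivity turns the product over the qubits into a double sum
  over bit strings.\<close>

lemma bilin_tensor_apply:
  "bilin n C (tensor_apply n U \<phi>) =
   bilin n (\<lambda>k i j. \<Sum>p\<in>{0, 1}. \<Sum>q\<in>{0, 1}. U k $$ (p, i) * U k $$ (q, j) * C k p q) \<phi>"
proof -
  let ?B = "bit_strings n"
  let ?u = "\<lambda>x z. \<Prod>k\<in>{1..n}. U k $$ (x k, z k)"
  let ?c = "\<lambda>x y. \<Prod>k\<in>{1..n}. C k (x k) (y k)"
  have kernel: "(\<Prod>k\<in>{1..n}. \<Sum>p\<in>{0, 1}. \<Sum>q\<in>{0, 1}. U k $$ (p, z k) * U k $$ (q, w k) * C k p q) =
      (\<Sum>x\<in>?B. \<Sum>y\<in>?B. ?u x z * ?u y w * ?c x y)" for z w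
  proof -
    have "(\<Prod>k\<in>{1..n}. \<Sum>p\<in>{0, 1}. \<Sum>q\<in>{0, 1}. U k $$ (p, z k) * U k $$ (q, w k) * C k p q) =
        (\<Sum>x\<in>?B. \<Prod>k\<in>{1..n}. \<Sum>q\<in>{0, 1}. U k $$ (x k, z k) * U k $$ (q, w k) * C k (x k) q)"
      unfolding bit_strings_def by (rule prod_sum_PiE) auto
    also have "\<dots> = (\<Sum>x\<in>?B. \<Sum>y\<in>?B.
        \<Prod>k\<in>{1..n}. U k $$ (x k, z k) * U k $$ (y k, w k) * C k (x k) (y k))"
      unfolding bit_strings_def by (intro sum.cong refl prod_sum_PiE) auto
    finally show ?thesis
      by (simp add: prod.distrib)
  qed
  have amplitudes: "tensor_apply n U \<phi> x * tensor_apply n U \<phi> y =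
      (\<Sum>z\<in>?B. \<Sum>w\<in>?B. (?u x z * \<phi> z) * (?u y w * \<phi> w))" if "x \<in> ?B" "y \<in> ?B" for x y
    using that by (simp add: tensor_apply_def sum_product)
  have "bilin n C (tensor_apply n U \<phi>) =
      (\<Sum>x\<in>?B. \<Sum>y\<in>?B. \<Sum>z\<in>?B. \<Sum>w\<in>?B. ?u x z * ?u y w * ?c x y * (\<phi> z * \<phi> w))"
    unfolding bilin_def
    by (intro sum.cong refl) (simp add: amplitudes sum_distrib_left mult_ac)
  also have "\<dots> = (\<Sum>x\<in>?B. \<Sum>z\<in>?B. \<Sum>y\<in>?B. \<Sum>w\<in>?B. ?u x z * ?u y w * ?c x y * (\<phi> z * \<phi> w))"
    by (intro sum.cong refl sum.swap)
  also have "\<dots> = (\<Sum>z\<in>?B. \<Sum>x\<in>?B. \<Sum>w\<in>?B. \<Sum>y\<in>?B. ?u x z * ?u y w * ?c x y * (\<phi> z * \<phi> w))"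
    by (subst sum.swap) (intro sum.cong refl sum.swap)
  also have "\<dots> = (\<Sum>z\<in>?B. \<Sum>w\<in>?B. \<Sum>x\<in>?B. \<Sum>y\<in>?B. ?u x z * ?u y w * ?c x y * (\<phi> z * \<phi> w))"
    by (intro sum.cong refl sum.swap)
  finally show ?thesis
    unfolding bilin_def kernel by (simp add: sum_distrib_right)
qed

text \<open>
  Qubits \<open>2, \<dots>, n\<close> are contracted with the antisymmetric form, whose value on bits is
  \<open>\<epsilon> i j = j - i\<close>; the index of qubit \<open>1\<close> is left open in both arguments.
\<close>

definition corner :: "nat \<Rightarrow> nat \<Rightarrow> nat \<Rightarrow> nat \<Rightarrow> nat \<Rightarrow> 'a::comm_ring_1" where
  "corner a b k i j = (if k = 1 then of_bool (i = a) * of_bool (j = b) else of_nat j - of_nat i)"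

definition form_entry :: "nat \<Rightarrow> ((nat \<Rightarrow> nat) \<Rightarrow> 'a) \<Rightarrow> nat \<Rightarrow> nat \<Rightarrow> 'a::comm_ring_1" where
  "form_entry n \<psi> a b = bilin n (corner a b) \<psi>"

definition form_det :: "nat \<Rightarrow> ((nat \<Rightarrow> nat) \<Rightarrow> 'a) \<Rightarrow> 'a::comm_ring_1" where
  "form_det n \<psi> =
    form_entry n \<psi> 0 0 * form_entry n \<psi> 1 1 - form_entry n \<psi> 0 1 * form_entry n \<psi> 1 0"

definition det2 :: "'a::comm_ring_1 mat \<Rightarrow> 'a" where
  "det2 A = A $$ (0, 0) * A $$ (1, 1) - A $$ (0, 1) * A $$ (1, 0)"

text \<open>On qubits 2 to \<open>n\<close> the antisymmetric form only picks up
  \<open>det2 (U k)\<close>. On qubit 1 the kernel is the matrix unit at \<open>(a, b)\<close>,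
  which \<open>U 1\<close> turns into a combination of the matrix units at
  \<open>(c, d)\<close>.\<close>

lemma form_entry_tensor_apply:
  assumes n: "1 \<le> n" and a: "a \<in> {0, 1}" and b: "b \<in> {0, 1}"
  shows "form_entry n (tensor_apply n U \<phi>) a b =
    (\<Prod>k\<in>{2..n}. det2 (U k)) *
      (\<Sum>c\<in>{0, 1}. \<Sum>d\<in>{0, 1}. U 1 $$ (a, c) * U 1 $$ (b, d) * form_entry n \<phi> c d)"
proof -
  let ?B = "bit_strings n"
  let ?V = "\<lambda>k i j. \<Sum>p\<in>{0, 1}. \<Sum>q\<in>{0, 1}. U k $$ (p, i) * U k $$ (q, j) * corner a b k p q"
  let ?D = "\<Prod>k\<in>{2..n}. det2 (U k)"
  have kernel: "(\<Prod>k\<in>{1..n}. ?V k (x k) (y k)) =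
      ?D * (\<Sum>c\<in>{0, 1}. \<Sum>d\<in>{0, 1}. U 1 $$ (a, c) * U 1 $$ (b, d) *
        (\<Prod>k\<in>{1..n}. corner c d k (x k) (y k)))"
    if x: "x \<in> ?B" and y: "y \<in> ?B" for x y
  proof -
    have bits: "x k = 0 \<or> x k = 1" "y k = 0 \<or> y k = 1" if "k \<in> {1..n}" for k
      using bit_strings_01 x y that by auto
    have tail: "?V k (x k) (y k) = det2 (U k) * (of_nat (y k) - of_nat (x k))" if "k \<in> {2..n}" for k
    proof -
      have "k \<in> {1..n}" "k \<noteq> 1"
        using that by auto
      with bits[of k] show ?thesis
        by (auto simp: corner_def det2_def)
    qed
    \<comment> \<open>Away from qubit 1 the kernel is the same for all \<open>c\<close> and
      \<open>d\<close>, so this factor leaves the double sum.\<close>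
    have corner_tail: "(\<Prod>k\<in>{2..n}. corner c d k (x k) (y k)) =
        (\<Prod>k\<in>{2..n}. of_nat (y k) - of_nat (x k) :: complex)" for c d
      by (rule prod.cong) (auto simp: corner_def)
    have "(\<Prod>k\<in>{2..n}. ?V k (x k) (y k)) = ?D * (\<Prod>k\<in>{2..n}. of_nat (y k) - of_nat (x k))"
      unfolding prod.distrib[symmetric] by (rule prod.cong) (use tail in auto)
    then show ?thesis
      unfolding prod_head[OF n] corner_tail
      using bits[of 1] n a b by (auto simp: corner_def)
  qed
  let ?K = "\<lambda>c d x y. \<Prod>k\<in>{1..n}. corner c d k (x k) (y k) :: complex"
  have "form_entry n (tensor_apply n U \<phi>) a b =
      (\<Sum>x\<in>?B. \<Sum>y\<in>?B. (?D * (\<Sum>c\<in>{0, 1}. \<Sum>d\<in>{0, 1}. U 1 $$ (a, c) * U 1 $$ (b, d) *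
        ?K c d x y)) * (\<phi> x * \<phi> y))"
    unfolding form_entry_def bilin_tensor_apply unfolding bilin_def
    by (intro sum.cong refl) (simp only: kernel)
  also have "\<dots> = ?D *
      (\<Sum>c\<in>{0, 1}. \<Sum>d\<in>{0, 1}. U 1 $$ (a, c) * U 1 $$ (b, d) * form_entry n \<phi> c d)"
    unfolding form_entry_def bilin_def
    by (simp add: sum_distrib_left sum.distrib algebra_simps)
  finally show ?thesis .
qed

text \<open>The scalar from qubits 2 to \<open>n\<close> multiplies a 2 by 2 matrix, so it enters
  the determinant squared, as does \<open>det2 (U 1)\<close> through
  \<open>U\<^sub>1 M U\<^sub>1\<^sup>T\<close>.\<close>

lemma form_det_tensor_apply:
  assumes "1 \<le> n"
  shows "form_det n (tensor_apply n U \<phi>) = (\<Prod>k\<in>{1..n}. det2 (U k))\<^sup>2 * form_det n \<phi>"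
  unfolding form_det_def prod_head[OF assms]
  by (simp add: form_entry_tensor_apply[OF assms] det2_def power2_eq_square) Groebner_Basis.algebra

section \<open>Invariance under local unitaries\<close>

lemma norm_det2_unitary:
  assumes "unitary_mat 2 U"
  shows "norm (det2 U) = 1"
proof -
  have U: "U \<in> carrier_mat 2 2" and one: "U * mat_adjoint U = 1\<^sub>m 2"
    using assms by (auto simp: unitary_mat_def)
  have two: "{0..<2} = {0, 1::nat}"
    by auto
  have entry: "U $$ (i, 0) * cnj (U $$ (j, 0)) + U $$ (i, 1) * cnj (U $$ (j, 1)) = of_bool (i = j)"
    if "i < 2" "j < 2" for i j
  proof -
    have "of_bool (i = j) = (U * mat_adjoint U) $$ (i, j)"
      unfolding one using that by simp
    also have "\<dots> = U $$ (i, 0) * cnj (U $$ (j, 0)) + U $$ (i, 1) * cnj (U $$ (j, 1))"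
      using U that by (simp add: mat_adjoint_def scalar_prod_def two mat_of_rows_def)
    finally show ?thesis
      by (rule sym)
  qed
  \<comment> \<open>This is the determinant of \<open>U * mat_adjoint U\<close>, expanded in
    entries.\<close>
  have "det2 U * cnj (det2 U) = 1"
    using entry[of 0 0] entry[of 0 1] entry[of 1 0] entry[of 1 1]
    unfolding det2_def by simp Groebner_Basis.algebra
  then show ?thesis
    by (metis complex_norm_square norm_one norm_ge_zero norm_mult complex_mod_cnj 
        mult_cancel_right1 abs_of_nonneg real_sqrt_abs2 real_sqrt_one)
qed

lemma norm_form_det_tensor_apply:
  assumes "1 \<le> n" and "\<And>k. k \<in> {1..n} \<Longrightarrow> unitary_mat 2 (U k)"
  shows "norm (form_det n (tensor_apply n U \<phi>)) = norm (form_det n \<phi>)"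
  using assms(2) unfolding form_det_tensor_apply[OF assms(1)]
  by (simp add: norm_mult norm_power prod_norm[symmetric] norm_det2_unitary)

section \<open>Hypergraph states as integer sign vectors\<close>

definition amp :: "nat set set \<Rightarrow> (nat \<Rightarrow> nat) \<Rightarrow> int" where
  "amp E x = (- 1) ^ parity_function E x"

text \<open>The entries are quadratic in the state and the determinant is quadratic in the entries,
  so the normalisation \<open>1 / sqrt (2 ^ n)\<close> enters to the fourth power.\<close>

lemma form_det_hypergraph_state:
  "form_det n (hypergraph_state n E) = of_int (form_det n (amp E)) / 4 ^ n"
proof -
  have entry: "form_entry n (hypergraph_state n E) a b = of_int (form_entry n (amp E) a b) / 2 ^ n" for a b
  proof -
    have corner: "corner a b k i j = (of_int (corner a b k i j) :: complex)" for k i j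
      by (simp add: corner_def)
    have sq: "complex_of_real (sqrt (2 ^ n)) * complex_of_real (sqrt (2 ^ n)) = 2 ^ n"
      by (simp flip: of_real_mult)
    show ?thesis
      unfolding form_entry_def bilin_def
      by (simp add: hypergraph_state_apply amp_def sum_divide_distrib sq corner[symmetric])
  qed
  have "(4::complex) ^ n = 2 ^ n * 2 ^ n"
    by (simp flip: power_mult_distrib)
  then show ?thesis
    by (simp add: form_det_def entry diff_divide_distrib)
qed

text \<open>Modulo 4 a sign is affine in its exponent, so the sum splits into \<open>2 ^ n\<close>
  and, for each edge, twice the number of bit strings on which it equals 1. Only the full edge has
  an odd count.\<close>

lemma sum_amp_cong:
  assumes "hypergraph {1..n} E" and "2 \<le> n"
  shows "[(\<Sum>x\<in>bit_strings n. amp E x) = 2 * of_bool ({1..n} \<in> E)] (mod 4)"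
proof -
  let ?B = "bit_strings n"
  have sub: "e \<subseteq> {1..n}" if "e \<in> E" for e
    using assms that by (auto simp: hypergraph_def)
  have fin: "finite E"
    using assms finite_subset[of E "Pow {1..n}"] by (auto simp: hypergraph_def)
  have sign: "[(- 1) ^ m = 1 + 2 * int m] (mod 4)" for m
    by (cases "even m") (auto elim!: evenE oddE simp: cong_iff_dvd_diff)
  \<comment> \<open>A sign depends only on the parity of its exponent, so \<open>sign\<close>
    applies to the edge sum before its reduction \<open>mod 2\<close>.\<close>
  have amp: "[amp E x = 1 + 2 * (\<Sum>e\<in>E. \<Prod>k\<in>e. int (x k))] (mod 4)" for x
    using sign[of "\<Sum>e\<in>E. \<Prod>k\<in>e. x k"]
    by (simp add: amp_def parity_function_def minus_one_power_iff)
  have edge: "[2 * (\<Sum>x\<in>?B. \<Prod>k\<in>e. int (x k)) = 2 * of_bool (e = {1..n})] (mod 4)" if "e \<in> E" for e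
  proof -
    \<comment> \<open>Padding with factors 1 to all of \<open>{1..n}\<close> lets the sum over bit
      strings factorise.\<close>
    have "(\<Prod>k\<in>e. int (x k)) = (\<Prod>k\<in>{1..n}. if k \<in> e then int (x k) else 1)" for x
      using sub[OF that] by (simp add: prod.If_cases Int_absorb1)
    then have "(\<Sum>x\<in>?B. \<Prod>k\<in>e. int (x k)) =
        (\<Prod>k\<in>{1..n}. (if k \<in> e then int 0 else 1) + (if k \<in> e then int 1 else 1))"
      by (simp only: sum_bit_strings_prod[of "\<lambda>k i. if k \<in> e then int i else 1" n])
    also have "\<dots> = (\<Prod>k\<in>{1..n}. if k \<in> e then 1 else 2)"
      by (rule prod.cong) auto
    also have "\<dots> = 2 ^ card ({1..n} - e)"
      by (simp add: prod.If_cases Diff_eq)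
    finally have sum: "(\<Sum>x\<in>?B. \<Prod>k\<in>e. int (x k)) = 2 ^ card ({1..n} - e)" .
    show ?thesis
    proof (cases "e = {1..n}")
      case True
      with sum show ?thesis
        by simp
    next
      case False
      with sub[OF that] have "card ({1..n} - e) \<noteq> 0"
        by auto
      then obtain m where "card ({1..n} - e) = Suc m"
        using not0_implies_Suc by blast
      with sum False show ?thesis
        by (simp add: cong_0_iff)
    qed
  qed
  have "[(\<Sum>x\<in>?B. amp E x) = (\<Sum>x\<in>?B. 1 + 2 * (\<Sum>e\<in>E. \<Prod>k\<in>e. int (x k)))] (mod 4)"
    by (intro cong_sum amp)
  also have "(\<Sum>x\<in>?B. 1 + 2 * (\<Sum>e\<in>E. \<Prod>k\<in>e. int (x k))) =
      2 ^ n + (\<Sum>e\<in>E. 2 * (\<Sum>x\<in>?B. \<Prod>k\<in>e. int (x k)))"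
    using sum_bit_strings_prod[of "\<lambda>k i. 1 :: int" n]
    by (simp add: sum.distrib sum_distrib_left sum.swap[of _ E])
  also have "[\<dots> = 0 + (\<Sum>e\<in>E. 2 * of_bool (e = {1..n}))] (mod 4)"
  proof (intro cong_add cong_sum edge)
    have "(2::int) ^ 2 dvd 2 ^ n"
      using assms(2) by (rule le_imp_power_dvd)
    then show "[2 ^ n = 0] (mod (4::int))"
      by (simp add: cong_0_iff)
  qed
  also have "(\<Sum>e\<in>E. 2 * of_bool (e = {1..n})) = (2 * of_bool ({1..n} \<in> E) :: int)"
    using fin by (simp add: of_bool_def sum_distrib_left[symmetric])
  finally show ?thesis
    by simp
qed

section \<open>The contraction modulo 4 for odd integer vectors\<close>

lemma odd_mult_cong:
  fixes s t c :: int
  assumes "odd s" and "odd t"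
  shows "[c * (s * t) = c * (s + t - 1)] (mod 4)"
proof -
  from assms obtain u v where "s = 2 * u + 1" "t = 2 * v + 1"
    by (elim oddE)
  then have "c * (s * t) - c * (s + t - 1) = 4 * (c * u * v)"
    by (simp add: algebra_simps)
  then show ?thesis
    by (simp add: cong_iff_dvd_diff)
qed

definition half_sum :: "nat \<Rightarrow> ((nat \<Rightarrow> nat) \<Rightarrow> int) \<Rightarrow> nat \<Rightarrow> int" where
  "half_sum n s a = (\<Sum>x\<in>bit_strings n. of_bool (x 1 = a) * s x)"

lemma half_sum_mult_cong:
  assumes "\<And>x. x \<in> bit_strings n \<Longrightarrow> odd (s x)" and "\<And>x. x \<in> bit_strings n \<Longrightarrow> odd (t x)"
  shows "[half_sum n (\<lambda>x. s x * t x) a = half_sum n s a + half_sum n t a - half_sum n (\<lambda>x. 1) a] (mod 4)"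
proof -
  have "half_sum n s a + half_sum n t a - half_sum n (\<lambda>x. 1) a =
      half_sum n (\<lambda>x. s x + t x - 1) a"
    by (simp add: half_sum_def sum.distrib sum_subtractf algebra_simps)
  then show ?thesis
    using assms by (auto simp: half_sum_def intro!: cong_sum odd_mult_cong)
qed

text \<open>The condition on bit 1 acts as a factor for qubit 1 that sums to 1 over its two
  values.\<close>

lemma half_sum_prod:
  assumes "1 \<le> n" and "a \<in> {0, 1}"
  shows "half_sum n (\<lambda>x. \<Prod>k\<in>{2..n}. f k (x k)) a = (\<Prod>k\<in>{2..n}. f k 0 + f k 1)"
proof -
  let ?g = "\<lambda>k i. if k = 1 then of_bool (i = a) else f k i"
  have tail: "(\<Prod>k\<in>{2..n}. ?g k (h k)) = (\<Prod>k\<in>{2..n}. f k (h k))" for h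
    by (rule prod.cong) auto
  have tail': "(\<Prod>k\<in>{2..n}. ?g k 0 + ?g k 1) = (\<Prod>k\<in>{2..n}. f k 0 + f k 1)"
    by (rule prod.cong) auto
  have "half_sum n (\<lambda>x. \<Prod>k\<in>{2..n}. f k (x k)) a = (\<Sum>x\<in>bit_strings n. \<Prod>k\<in>{1..n}. ?g k (x k))"
    unfolding half_sum_def prod_head[OF assms(1)] tail by simp
  also have "\<dots> = (\<Prod>k\<in>{2..n}. f k 0 + f k 1)"
    unfolding sum_bit_strings_prod[of ?g n] unfolding prod_head[OF assms(1)] tail' using assms(2) by auto
  finally show ?thesis .
qed

text \<open>Replacing \<open>s x * s y\<close> by \<open>s x + s y - 1\<close> leaves terms in one
  argument each, so the kernel can be summed over the other. This produces odd weights, which the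
  same linearisation removes.\<close>

lemma form_entry_cong:
  assumes n: "2 \<le> n" and ab: "a \<in> {0, 1}" "b \<in> {0, 1}"
    and odd: "\<And>x. x \<in> bit_strings n \<Longrightarrow> odd (s x)"
  shows "[form_entry n s a b = half_sum n s a + half_sum n s b] (mod 4)"
proof -
  let ?B = "bit_strings n"
  let ?c = "\<lambda>x y. \<Prod>k\<in>{1..n}. corner a b k (x k) (y k) :: int"
  \<comment> \<open>Factors of \<open>t\<close> and \<open>u\<close> are row and column sums of the
    antisymmetric form: \<open>(0 - i) + (1 - i)\<close> and
    \<open>(j - 0) + (j - 1)\<close>.\<close>
  define t where "t x = (\<Prod>k\<in>{2..n}. 1 - 2 * int (x k))" for x :: "nat \<Rightarrow> nat"
  define u where "u x = (\<Prod>k\<in>{2..n}. 2 * int (x k) - 1)" for x :: "nat \<Rightarrow> nat"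
  have n1: "1 \<le> n"
    using n by simp
  have odd': "odd (t x)" "odd (u x)" for x
    unfolding t_def u_def by (auto simp: even_prod_iff)
  have row: "(\<Sum>y\<in>?B. ?c x y) = of_bool (x 1 = a) * t x" for x
  proof -
    have tail: "(\<Prod>k\<in>{2..n}. corner a b k (x k) 0 + corner a b k (x k) 1) = t x"
      unfolding t_def by (rule prod.cong) (auto simp: corner_def)
    have "(\<Prod>k\<in>{1..n}. corner a b k (x k) 0 + corner a b k (x k) 1) = of_bool (x 1 = a) * t x"
      unfolding prod_head[OF n1] tail using ab by (auto simp: corner_def)
    then show ?thesis
      by (simp only: sum_bit_strings_prod[of "\<lambda>k i. corner a b k (x k) i" n])
  qed
  have col: "(\<Sum>x\<in>?B. ?c x y) = of_bool (y 1 = b) * u y" for y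
  proof -
    have tail: "(\<Prod>k\<in>{2..n}. corner a b k 0 (y k) + corner a b k 1 (y k)) = u y"
      unfolding u_def by (rule prod.cong) (auto simp: corner_def)
    have "(\<Prod>k\<in>{1..n}. corner a b k 0 (y k) + corner a b k 1 (y k)) = of_bool (y 1 = b) * u y"
      unfolding prod_head[OF n1] tail using ab by (auto simp: corner_def)
    then show ?thesis
      by (simp only: sum_bit_strings_prod[of "\<lambda>k i. corner a b k i (y k)" n])
  qed
  \<comment> \<open>The two values of each factor cancel, and \<open>{2..n}\<close> is nonempty
    because \<open>n \<ge> 2\<close>.\<close>
  have zero: "half_sum n t a = 0" "half_sum n u b = 0"
    using n ab half_sum_prod[of n a "\<lambda>k i. 1 - 2 * int i"] half_sum_prod[of n b "\<lambda>k i. 2 * int i - 1"]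
    by (simp_all add: t_def[abs_def] u_def[abs_def])
  have one: "half_sum n (\<lambda>x. 1) c = 2 ^ (n - 1)" if "c \<in> {0, 1}" for c
    using half_sum_prod[of n c "\<lambda>k i. 1"] that n by simp
  have "[form_entry n s a b = (\<Sum>x\<in>?B. \<Sum>y\<in>?B. ?c x y * (s x + s y - 1))] (mod 4)"
    unfolding form_entry_def bilin_def by (intro cong_sum odd_mult_cong odd)
  also have "(\<Sum>x\<in>?B. \<Sum>y\<in>?B. ?c x y * (s x + s y - 1)) =
      (\<Sum>x\<in>?B. (\<Sum>y\<in>?B. ?c x y) * s x) + (\<Sum>x\<in>?B. \<Sum>y\<in>?B. ?c x y * s y)
        - (\<Sum>x\<in>?B. \<Sum>y\<in>?B. ?c x y)"
    by (simp add: algebra_simps sum.distrib sum_subtractf sum_distrib_left)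
  also have "(\<Sum>x\<in>?B. \<Sum>y\<in>?B. ?c x y * s y) = (\<Sum>y\<in>?B. (\<Sum>x\<in>?B. ?c x y) * s y)"
    by (subst sum.swap) (simp add: sum_distrib_right)
  also have "(\<Sum>x\<in>?B. (\<Sum>y\<in>?B. ?c x y) * s x) + (\<Sum>y\<in>?B. (\<Sum>x\<in>?B. ?c x y) * s y)
        - (\<Sum>x\<in>?B. \<Sum>y\<in>?B. ?c x y) =
      half_sum n (\<lambda>x. t x * s x) a + half_sum n (\<lambda>x. u x * s x) b - half_sum n t a"
    by (simp only: row col half_sum_def mult.assoc)
  also have "[\<dots> = (half_sum n t a + half_sum n s a - half_sum n (\<lambda>x. 1) a) +
      (half_sum n u b + half_sum n s b - half_sum n (\<lambda>x. 1) b) - half_sum n t a] (mod 4)"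
    using odd odd' by (intro cong_add cong_diff half_sum_mult_cong cong_refl) auto
  also have "(half_sum n t a + half_sum n s a - half_sum n (\<lambda>x. 1) a) +
      (half_sum n u b + half_sum n s b - half_sum n (\<lambda>x. 1) b) - half_sum n t a =
      half_sum n s a + half_sum n s b - 2 ^ n"
    unfolding zero one[OF ab(1)] one[OF ab(2)] using n by (cases n) simp_all
  also have "[\<dots> = half_sum n s a + half_sum n s b] (mod 4)"
  proof -
    have "(2::int) ^ 2 dvd 2 ^ n"
      using n by (rule le_imp_power_dvd)
    then show ?thesis
      by (simp add: cong_iff_dvd_diff)
  qed
  finally show ?thesis .
qed

text \<open>The diagonal entries are \<open>2 * half_sum n s a\<close>, hence 0 modulo 4, and the
  off-diagonal ones are the full sum modulo 4. Writing them as \<open>2 * of_bool b\<close> plus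
  multiples of 4 fixes their product modulo 8.\<close>

lemma form_det_cong:
  fixes s :: "(nat \<Rightarrow> nat) \<Rightarrow> int"
  assumes n: "2 \<le> n" and odd: "\<And>x. x \<in> bit_strings n \<Longrightarrow> odd (s x)"
    and b: "[(\<Sum>x\<in>bit_strings n. s x) = 2 * of_bool b] (mod 4)"
  shows "[form_det n s = 4 * of_bool b] (mod 8)"
proof -
  have even: "even (half_sum n s a)" if "a \<in> {0, 1}" for a
  proof -
    \<comment> \<open>Odd terms give the sum the parity of their number,
      \<open>2 ^ (n - 1)\<close>.\<close>
    have "even (half_sum n s a - half_sum n (\<lambda>x. 1) a)"
      using odd unfolding half_sum_def sum_subtractf[symmetric] by (intro dvd_sum) auto
    moreover have "half_sum n (\<lambda>x. 1) a = 2 ^ (n - 1)"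
      using half_sum_prod[of n a "\<lambda>k i. 1"] that n by simp
    ultimately show ?thesis
      using n by simp
  qed
  obtain p q where p: "half_sum n s 0 = 2 * p" and q: "half_sum n s 1 = 2 * q"
    using even[of 0] even[of 1] by (auto elim!: evenE)
  have "half_sum n s 0 + half_sum n s 1 = (\<Sum>x\<in>bit_strings n. s x)"
    unfolding half_sum_def sum.distrib[symmetric]
  proof (rule sum.cong)
    fix x assume "x \<in> bit_strings n"
    then have "x 1 = 0 \<or> x 1 = 1"
      using n by (intro bit_strings_01) auto
    then show "of_bool (x 1 = 0) * s x + of_bool (x 1 = 1) * s x = s x"
      by auto
  qed simp
  with b have sum: "[2 * p + 2 * q = 2 * of_bool b] (mod 4)"
    by (simp only: p q)
  have "[form_entry n s 0 0 = 0] (mod 4)" "[form_entry n s 1 1 = 0] (mod 4)"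
    "[form_entry n s 0 1 = 2 * of_bool b] (mod 4)" "[form_entry n s 1 0 = 2 * of_bool b] (mod 4)"
    using form_entry_cong[OF n, of 0 0 s] form_entry_cong[OF n, of 1 1 s]
      form_entry_cong[OF n, of 0 1 s] form_entry_cong[OF n, of 1 0 s] odd sum
    by (auto simp: p q[unfolded One_nat_def] cong_iff_dvd_diff) presburger+
  then obtain e f g h where "form_entry n s 0 0 = 4 * e" "form_entry n s 1 1 = 4 * f"
    "form_entry n s 0 1 = 2 * of_bool b + 4 * g" "form_entry n s 1 0 = 2 * of_bool b + 4 * h"
    unfolding cong_iff_lin by (metis add_0 cong_iff_lin cong_sym mult.commute)
  \<comment> \<open>The off-diagonal product is subtracted, but \<open>-4\<close> and 4 agree modulo
    8; this is the lone \<open>- of_bool b\<close>.\<close>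
  then have "form_det n s - 4 * of_bool b =
      8 * (2 * e * f - of_bool b - of_bool b * g - of_bool b * h - 2 * g * h)"
    by (simp add: form_det_def algebra_simps split: split_of_bool)
  then show ?thesis
    unfolding cong_iff_dvd_diff by (simp only: dvd_triv_left)
qed

theorem proposition8:
  fixes n :: nat and E :: "nat set set"
  assumes "n \<ge> 2"
    and "hypergraph {1..n} E"
    and "{1..n} \<in> E"
  shows "\<not> (\<exists>E'. hypergraph {1..n} E' \<and> {1..n} \<notin> E' \<and> LU_equivalent n E E')"
proof
  have cong: "[form_det n (amp F) = 4 * of_bool ({1..n} \<in> F)] (mod 8)" if "hypergraph {1..n} F" for F
    using sum_amp_cong[OF that assms(1)] by (intro form_det_cong assms(1)) (auto simp: amp_def)
  assume "\<exists>E'. hypergraph {1..n} E' \<and> {1..n} \<notin> E' \<and> LU_equivalent n E E'"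
  then obtain E' U where E': "hypergraph {1..n} E'" "{1..n} \<notin> E'"
    and U: "\<forall>k\<in>{1..n}. unitary_mat 2 (U k)"
    and eq: "hypergraph_state n E = tensor_apply n U (hypergraph_state n E')"
    by (auto simp: LU_equivalent_def)
  have "norm (form_det n (hypergraph_state n E)) = norm (form_det n (hypergraph_state n E'))"
    unfolding eq using U assms(1) by (intro norm_form_det_tensor_apply) auto
  then have "\<bar>real_of_int (form_det n (amp E))\<bar> = \<bar>real_of_int (form_det n (amp E'))\<bar>"
    by (simp add: form_det_hypergraph_state norm_divide norm_power)
  then have "\<bar>form_det n (amp E)\<bar> = \<bar>form_det n (amp E')\<bar>"
    by linarith
  \<comment> \<open>Divisibility by 8 ignores the sign, so equal absolute values are enough to
    compare 4 with 0 modulo 8.\<close>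
  moreover have "8 dvd form_det n (amp E')" "\<not> 8 dvd form_det n (amp E)"
    using cong[OF assms(2)] cong[OF E'(1)] assms(3) E'(2) by (auto simp: cong_def dvd_eq_mod_eq_0)
  ultimately show False
    by (metis dvd_abs_iff)
qed

end
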